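(* Let $k\in \mathbb{Z}_{\geq 0}$ and let $b$ be a $k$-generalized Markov number. If $b=p$ or $b=2p$ for some prime $p$, then there is a unique $k$-generalized Markov triple $(a,b,c)$, up to order, such that $\max\{a,b,c\}=b$.
   Context: For $k\in\mathbb{Z}_{\ge 0}$, the $k$-generalized Markov equation is $x^2+y^2+z^2+k(yz+zx+xy)=(3+3k)xyz$. A $k$-generalized Markov triple is a positive integer solution $(a,b,c)$ of this equation (considered up to order when counting). A $k$-generalized Markov number is a positive integer appearing as an entry of some $k$-generalized Markov triple. *)

theory Defs
  imports "HOL-Library.Multiset" "HOL-Computational_Algebra.Primes"
begin

definition gen_markov_triple :: "nat \<Rightarrow> nat \<Rightarrow> nat \<Rightarrow> nat \<Rightarrow> bool" where
  "gen_markov_triple k x y z \<longleftrightarrow>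
     x > 0 \<and> y > 0 \<and> z > 0 \<and>
     x^2 + y^2 + z^2 + k * (y * z + z * x + x * y) = (3 + 3 * k) * x * y * z"

definition gen_markov_number :: "nat \<Rightarrow> nat \<Rightarrow> bool" where
  "gen_markov_number k n \<longleftrightarrow>
     (\<exists>x y z. gen_markov_triple k x y z \<and> n \<in> {x, y, z})"

end

(* Let (a,b,c) and (a',b,c') be triples with maximum b. Translating the quadric in (a,c) to its
   centre kb/D, with D = (3+3k)b - k - 2, and multiplying crosswise gives an identity in which the
   product of P = D(ac' - a'c) - kb(a-c+c'-a') and Q = D(cc' - aa') - kb(c+c'-a-a') is divisible
   by b^2. If b is p or 2p and p is odd and prime to k+2 and k-2, then b^2 divides P or Q, say P,
   and b divides ac' - a'c. As D is -(k+2) modulo b, it follows that b divides (k+2)(ac' - a'c)/b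
   + k(a-c+c'-a'). The bound (2k+2)c <= b + k makes this number smaller than b in absolute value,
   so it vanishes; both of its summands have the same sign, because a decreases when c increases,
   and the triples agree. The case of Q is similar. Vieta descent supplies coprimality and a
   triple with maximum b. *)

theory Submission
  imports Defs
begin

section \<open>Bounds and monotonicity for a single triple\<close>

locale max_triple =
  fixes k a b c :: int
  assumes k: "0 \<le> k" and a: "1 \<le> a" and ac: "a \<le> c" and cb: "c \<le> b" and b: "2 \<le> b"
    and eq: "a\<^sup>2 + b\<^sup>2 + c\<^sup>2 + k * (b * c + c * a + a * b) = (3 + 3 * k) * a * b * c"
begin

text \<open>Product of the two roots of the equation read as a quadratic in \<open>b\<close>; the
  second factor is the conjugate root.\<close>

lemma vieta:
  "b * ((3 + 3 * k) * a * c - k * (a + c) - b) = a\<^sup>2 + c\<^sup>2 + k * a * c"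
  using eq by (simp add: algebra_simps power2_eq_square)

text \<open>The quadratic with roots \<open>b\<close> and \<open>?v\<close>, evaluated at
  \<open>c\<close>, is minus a sum of nonnegative terms, so \<open>c\<close> lies between the roots.
  If \<open>c = b\<close>, that sum vanishes and forces \<open>a = c = 1\<close>, against
  \<open>2 \<le> b\<close>.\<close>

lemma conj_le: "(3 + 3 * k) * a * c - k * (a + c) - b \<le> c"
  and c_less: "c < b"
proof -
  let ?v = "(3 + 3 * k) * a * c - k * (a + c) - b"
  have "(c - b) * (c - ?v) = c * (c - b) - c * ?v + b * ?v"
    by (simp add: algebra_simps)
  also have "\<dots> = c\<^sup>2 * (2 + k - (3 + 3 * k) * a) + 2 * k * a * c + a\<^sup>2"
    unfolding vieta by (simp add: algebra_simps power2_eq_square)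
  also have "\<dots> = - ((c - a) * (c + a) + 3 * (a - 1) * c\<^sup>2 + 2 * k * a * c * (c - 1)
                        + k * (a - 1) * c\<^sup>2)"
    by (simp add: algebra_simps power2_eq_square)
  finally have f: "(b - c) * (c - ?v) = (c - a) * (c + a) + 3 * (a - 1) * c\<^sup>2
      + 2 * k * a * c * (c - 1) + k * (a - 1) * c\<^sup>2"
    by (simp add: algebra_simps)
  have nn: "0 \<le> (c - a) * (c + a)" "0 \<le> 3 * (a - 1) * c\<^sup>2" "0 \<le> 2 * k * a * c * (c - 1)"
    "0 \<le> k * (a - 1) * c\<^sup>2"
    using k a ac by simp_all
  show *: "c < b"
  proof (rule ccontr)
    assume "\<not> c < b"
    hence bc: "c = b" using cb by simp
    have "(b - c) * (c - ?v) = 0" using bc by simp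
    hence "(c - a) * (c + a) = 0" "3 * (a - 1) * c\<^sup>2 = 0"
      using f nn by linarith+
    hence "a = c" "a = 1" using a ac by auto
    thus False using bc b by simp
  qed
  have "0 \<le> (b - c) * (c - ?v)" using f nn by simp
  thus "?v \<le> c" using * by (simp add: zero_le_mult_iff)
qed

lemma conj_pos: "0 < (3 + 3 * k) * a * c - k * (a + c) - b"
proof -
  have "0 < a\<^sup>2 + c\<^sup>2 + k * a * c" using k a ac by (simp add: add_pos_nonneg)
  hence "0 < b * ((3 + 3 * k) * a * c - k * (a + c) - b)" unfolding vieta .
  thus ?thesis using b by (simp add: zero_less_mult_iff)
qed

text \<open>The left side of \<open>conj_le\<close> increases with \<open>a\<close>, and at
  \<open>a = 1\<close> that inequality is exactly this bound.\<close>

lemma c_bound: "(2 * k + 2) * c \<le> b + k"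
proof -
  have "0 \<le> (a - 1) * (3 * c + k * (3 * c - 1))"
    using k a ac by simp
  thus ?thesis using conj_le by (simp add: algebra_simps)
qed

lemma b_bound: "k + 2 \<le> b"
proof -
  have "(2 * k + 2) * 1 \<le> (2 * k + 2) * c" using k a ac by (intro mult_left_mono) auto
  thus ?thesis using c_bound by simp
qed

lemma c_mult_le: "(k + 2) * c \<le> b"
proof -
  have "(2 * k + 2) * ((k + 2) * c) \<le> (k + 2) * (b + k)"
    using mult_left_mono[OF c_bound, of "k + 2"] k by (simp add: mult.left_commute)
  also have "\<dots> \<le> (2 * k + 2) * b"
    using mult_left_mono[OF b_bound, of k] k by (simp add: algebra_simps)
  finally show ?thesis using k by simp
qed

end

text \<open>The difference is \<open>a' - a\<close> times a factor that is negative, since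
  \<open>a + a' < 2 * b\<close> and both \<open>b\<close> and \<open>c\<close> are at most
  \<open>b * c\<close>.\<close>

lemma markov_decreasing:
  fixes k a a' b c :: int
  assumes "0 \<le> k" "1 \<le> b" "1 \<le> c" "a < a'" "a' \<le> b" "c \<le> b"
  shows "a'\<^sup>2 + b\<^sup>2 + c\<^sup>2 + k * (b * c + c * a' + a' * b) - (3 + 3 * k) * a' * b * c
       < a\<^sup>2 + b\<^sup>2 + c\<^sup>2 + k * (b * c + c * a + a * b) - (3 + 3 * k) * a * b * c"
proof -
  have 1: "b \<le> b * c" "c \<le> b * c" using assms by simp_all
  have "k * b \<le> k * (b * c)" "k * c \<le> k * (b * c)" "0 \<le> k * (b * c)"
    using assms 1 by (auto intro: mult_left_mono)
  moreover have "0 < b * c" using assms by simp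
  ultimately have "a + a' + k * b + k * c - (3 * (b * c) + 3 * (k * (b * c))) < 0"
    using 1 assms by linarith
  hence "(a' - a) * (a + a' + k * b + k * c - (3 * (b * c) + 3 * (k * (b * c)))) < 0"
    using assms by (simp add: mult_less_0_iff)
  thus ?thesis by (simp add: algebra_simps power2_eq_square)
qed

section \<open>Two triples with a common maximum\<close>

locale max_triple_pair =
  T: max_triple k a b c + T': max_triple k a' b c' for k a b c a' c'
begin

text \<open>If \<open>c \<le> c'\<close>, passing from \<open>(a, c)\<close> through
  \<open>(a', c)\<close> to \<open>(a', c')\<close> strictly lowers \<open>?f\<close>, although it
  vanishes at both ends.\<close>

lemma a_less_imp: "a < a' \<Longrightarrow> c' < c"
proof (rule ccontr)
  assume *: "a < a'" "\<not> c' < c"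
  let ?f = "\<lambda>a c. a\<^sup>2 + b\<^sup>2 + c\<^sup>2 + k * (b * c + c * a + a * b) - (3 + 3 * k) * a * b * c"
  have sym: "?f x y = ?f y x" for x y by (simp add: algebra_simps)
  have "?f a' c < ?f a c"
    using * T.k T.a T.ac T'.ac T.cb T'.cb T.b by (intro markov_decreasing) auto
  moreover have "?f a' c' \<le> ?f a' c"
  proof (cases "c = c'")
    case False
    have "?f c' a' < ?f c a'"
      using False * T.k T'.a T.ac T'.ac T.cb T'.cb T.b by (intro markov_decreasing) auto
    thus ?thesis using sym[of c' a'] sym[of c a'] by linarith
  qed simp
  moreover have "?f a c = 0" "?f a' c' = 0" using T.eq T'.eq by simp_all
  ultimately show False by simp
qed

lemma c_less_imp: "c < c' \<Longrightarrow> a' < a"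
proof (rule ccontr)
  assume *: "c < c'" "\<not> a' < a"
  show False
  proof (cases "a < a'")
    case True
    thus False using a_less_imp * by simp
  next
    case False
    hence "a = a'" using * by simp
    have "c'\<^sup>2 + b\<^sup>2 + a\<^sup>2 + k * (b * a + a * c' + c' * b) - (3 + 3 * k) * c' * b * a
       < c\<^sup>2 + b\<^sup>2 + a\<^sup>2 + k * (b * a + a * c + c * b) - (3 + 3 * k) * c * b * a"
      using * T.k T.a T.ac T.cb T'.cb T.b by (intro markov_decreasing) auto
    thus False using T.eq T'.eq \<open>a = a'\<close> by (simp add: algebra_simps)
  qed
qed

text \<open>With \<open>A = D * a - k * b\<close> and likewise \<open>C\<close>, \<open>A'\<close>,
  \<open>C'\<close>, one has \<open>A * C' - A' * C = D * (D * X - k * b * V)\<close> and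
  \<open>C * C' - A * A' = D * (D * Y - k * b * W)\<close>. Exchanging \<open>a\<close> and
  \<open>c\<close> turns \<open>X\<close>, \<open>V\<close> into \<open>Y\<close>,
  \<open>W\<close>.\<close>

abbreviation "D \<equiv> (3 + 3 * k) * b - k - 2"
abbreviation "X \<equiv> a * c' - a' * c"
abbreviation "V \<equiv> a - c + c' - a'"
abbreviation "Y \<equiv> c * c' - a * a'"
abbreviation "W \<equiv> c + c' - a - a'"

lemma D_pos: "0 < D"
proof -
  have "(3 + 3 * k) * 2 \<le> (3 + 3 * k) * b" using T.k T.b by (intro mult_left_mono) auto
  thus ?thesis using T.k by (simp add: algebra_simps)
qed

text \<open>With \<open>A = D a - k b\<close> and \<open>C = D c - k b\<close>, the equation becomes
  \<open>A\<^sup>2 + C\<^sup>2 = (D + 2) A C - K\<close> with \<open>K\<close> depending only on \<open>k\<close> and \<open>b\<close>.\<close>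
lemma product_identity:
  "(D * X - k * b * V) * (D * Y - k * b * W)
     = (k + 1) * (3 * b + k - 2) * b\<^sup>2 * (D * (a' * c' - a * c) - k * b * (a' + c' - a - c))"
  (is "?P * ?Q = _ * ?R")
proof -
  define d where "d = D"
  define A C A' C' where "A = d * a - k * b" and "C = d * c - k * b"
    and "A' = d * a' - k * b" and "C' = d * c' - k * b"
  define K where "K = d * ((k + 1) * (3 * b + k - 2) * b\<^sup>2)"
  have 1: "A\<^sup>2 + C\<^sup>2 = (d + 2) * A * C - K"
    unfolding A_def C_def K_def d_def using T.eq by algebra
  have 2: "A'\<^sup>2 + C'\<^sup>2 = (d + 2) * A' * C' - K"
    unfolding A'_def C'_def K_def d_def using T'.eq by algebra
  have "d\<^sup>2 * (?P * ?Q) = (A * C' - A' * C) * (C * C' - A * A')"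
    unfolding A_def C_def A'_def C'_def d_def by algebra
  also have "\<dots> = A * C * (A'\<^sup>2 + C'\<^sup>2) - A' * C' * (A\<^sup>2 + C\<^sup>2)" by algebra
  \<comment> \<open>Both substitutions produce \<open>(d + 2) * A * C * A' * C'\<close>, and these
    terms cancel.\<close>
  also have "\<dots> = K * (A' * C' - A * C)" unfolding 1 2 by algebra
  also have "\<dots> = d\<^sup>2 * ((k + 1) * (3 * b + k - 2) * b\<^sup>2 * ?R)"
    unfolding K_def A_def C_def A'_def C'_def d_def by algebra
  finally show ?thesis using D_pos unfolding d_def by simp
qed

text \<open>The size estimate for \<open>dvd_zero\<close>, scaled by \<open>b\<close>. The first
  summand is at most \<open>b * c'\<close> by \<open>c_mult_le\<close>; then
  \<open>c' + k * (c + c' - 2) < b\<close> follows from \<open>c_bound\<close> after multiplication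
  by \<open>2 * k + 2\<close>.\<close>

lemma cc_bound: "(k + 2) * (c * c') + b * (k * (c + c' - 2)) < b * b"
proof -
  have c1: "1 \<le> c" "1 \<le> c'" using T.a T.ac T'.a T'.ac by simp_all
  have 1: "(k + 2) * (c * c') \<le> b * c'"
    using mult_right_mono[OF T.c_mult_le, of c'] c1 by (simp add: mult.assoc)
  have "k * ((2 * k + 2) * c) \<le> k * (b + k)" "k * ((2 * k + 2) * c') \<le> k * (b + k)"
    using T.k T.c_bound T'.c_bound by (auto intro: mult_left_mono)
  hence "(2 * k + 2) * (c' + k * (c + c' - 2)) \<le> b + k + 2 * (k * (b + k)) - 2 * k * (2 * k + 2)"
    using T'.c_bound by (simp add: algebra_simps)
  also have "\<dots> < (2 * k + 2) * b"
  proof -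
    have "0 \<le> k * k" "0 < b" using T.k T.b by auto
    thus ?thesis using T.k by (simp add: algebra_simps add_pos_nonneg)
  qed
  finally have "c' + k * (c + c' - 2) < b" using T.k by simp
  hence "b * (c' + k * (c + c' - 2)) < b * b" using T.b by simp
  thus ?thesis using 1 by (simp add: algebra_simps)
qed

text \<open>With \<open>x = b * u\<close>, the number \<open>(k + 2) * u + k * w\<close> is
  divisible by \<open>b\<close>, as \<open>D\<close> is \<open>-(k + 2)\<close> modulo
  \<open>b\<close>, and smaller than \<open>b\<close> in absolute value by \<open>cc_bound\<close>.
  The conclusion is \<open>b\<close> times its vanishing.\<close>

lemma dvd_zero:
  assumes "b dvd x" "b\<^sup>2 dvd D * x - k * b * w" "\<bar>x\<bar> \<le> c * c'" "\<bar>w\<bar> \<le> c + c' - 2"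
  shows "(k + 2) * x + b * k * w = 0"
proof -
  obtain u where u: "x = b * u" using assms(1) by blast
  have "D * x - k * b * w = b * (D * u - k * w)" unfolding u by (simp add: algebra_simps)
  hence "b dvd D * u - k * w" using assms(2) T.b by (simp add: power2_eq_square)
  moreover have "(k + 2) * u + k * w = b * ((3 + 3 * k) * u) - (D * u - k * w)"
    by (simp add: algebra_simps)
  ultimately have dvd: "b dvd (k + 2) * u + k * w" by (metis dvd_diff dvd_triv_left)
  have "b * \<bar>(k + 2) * u + k * w\<bar> = \<bar>(k + 2) * x + b * (k * w)\<bar>"
    using T.b abs_mult[of b "(k + 2) * u + k * w"] unfolding u by (simp add: algebra_simps)
  also have "\<dots> \<le> (k + 2) * \<bar>x\<bar> + b * (k * \<bar>w\<bar>)"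
    using T.b T.k by (simp add: abs_mult order.trans[OF abs_triangle_ineq])
  also have "\<dots> \<le> (k + 2) * (c * c') + b * (k * (c + c' - 2))"
    using assms(3,4) T.b T.k by (intro add_mono mult_left_mono) auto
  also note cc_bound
  finally have "\<bar>(k + 2) * u + k * w\<bar> < b" using T.b by simp
  hence "(k + 2) * u + k * w = 0" using dvd zdvd_not_zless[of "\<bar>(k + 2) * u + k * w\<bar>" b]
    by (cases "(k + 2) * u + k * w = 0") auto
  hence "b * ((k + 2) * u + k * w) = 0" by simp
  thus ?thesis unfolding u by (simp add: algebra_simps)
qed

text \<open>If \<open>c < c'\<close>, then \<open>a' < a\<close>, so in the relation from
  \<open>dvd_zero\<close> one summand is positive and the other nonnegative; \<open>c' < c\<close>
  reverses the signs.\<close>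

lemma eq_if_dvd_X:
  assumes "b dvd X" "b\<^sup>2 dvd D * X - k * b * V"
  shows "a = a' \<and> c = c'"
proof -
  have nn: "0 \<le> a * c'" "0 \<le> a' * c" using T.a T.ac T'.a T'.ac by simp_all
  have "a * c' \<le> c * c'" "a' * c \<le> c' * c"
    using T.a T.ac T'.a T'.ac by (auto intro: mult_right_mono)
  hence X: "\<bar>X\<bar> \<le> c * c'" using nn by (simp add: abs_le_iff mult.commute)
  have "\<bar>V\<bar> \<le> c + c' - 2" using T.a T.ac T'.a T'.ac by linarith
  from dvd_zero[OF assms X this] have z: "(k + 2) * X + b * k * V = 0" .
  have "\<not> c < c'"
  proof
    assume *: "c < c'"
    hence "a' < a" by (rule c_less_imp)
    hence "a' * c < a * c'" using * T.a T.ac T'.a by (intro mult_strict_mono) auto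
    hence "0 < (k + 2) * X" using T.k by simp
    moreover have "0 \<le> b * k * V" using * \<open>a' < a\<close> T.k T.b by (intro mult_nonneg_nonneg) auto
    ultimately show False using z by linarith
  qed
  moreover have "\<not> c' < c"
  proof
    assume *: "c' < c"
    interpret S: max_triple_pair k a' b c' a c ..
    have "a < a'" using * by (rule S.c_less_imp)
    hence "a * c' < a' * c" using * T.a T'.a T'.ac by (intro mult_strict_mono) auto
    hence "(k + 2) * X < 0" using T.k by (intro mult_pos_neg) auto
    moreover have "b * k * V \<le> 0" using * \<open>a < a'\<close> T.k T.b
      by (intro mult_nonneg_nonpos mult_nonneg_nonneg) auto
    ultimately show False using z by linarith
  qed
  ultimately have "c = c'" by simp
  \<comment> \<open>Once \<open>c = c'\<close>, a strict order between \<open>a\<close> and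
    \<open>a'\<close> would force one between \<open>c\<close> and \<open>c'\<close>.\<close>
  interpret S: max_triple_pair k a' b c' a c ..
  show ?thesis using \<open>c = c'\<close> a_less_imp S.a_less_imp by force
qed

text \<open>Both summands are nonnegative because the triples are sorted, so \<open>Y = 0\<close>.
  The chain \<open>a * a' \<le> c * a' \<le> c * c'\<close> collapses to \<open>a = c\<close> and
  \<open>a' = c'\<close>, and \<open>a_less_imp\<close> excludes two different such triples.\<close>

lemma eq_if_dvd_Y:
  assumes "b dvd Y" "b\<^sup>2 dvd D * Y - k * b * W"
  shows "a = a' \<and> c = c'"
proof -
  have pos: "0 < a * a'" using T.a T'.a by simp
  have le: "a * a' \<le> c * a'" "c * a' \<le> c * c'"
    using T.a T.ac T'.a T'.ac by (auto intro: mult_right_mono mult_left_mono)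
  have Y: "\<bar>Y\<bar> \<le> c * c'" using le pos by simp
  have W: "\<bar>W\<bar> \<le> c + c' - 2" "0 \<le> W" using T.a T.ac T'.a T'.ac by linarith+
  have "(k + 2) * Y + b * k * W = 0" by (rule dvd_zero[OF assms Y W(1)])
  moreover have "0 \<le> (k + 2) * Y" "0 \<le> b * k * W"
    using T.k T.b le W(2) by simp_all
  ultimately have "(k + 2) * Y = 0" by linarith
  hence "Y = 0" using T.k by simp
  hence eqs: "a * a' = c * a'" "c * a' = c * c'" using le by linarith+
  hence "a = c" "a' = c'" using T.a T.ac T'.a by auto
  interpret S: max_triple_pair k a' b c' a c ..
  show ?thesis using \<open>a = c\<close> \<open>a' = c'\<close> a_less_imp S.a_less_imp by force
qed

text \<open>By \<open>c_bound\<close>, \<open>c \<ge> 2\<close> needs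
  \<open>4 * k + 4 \<le> b + k\<close>; below this threshold both triples have
  \<open>a = c = 1\<close>.\<close>

lemma eq_if_small:
  assumes "b < 3 * k + 4"
  shows "a = a' \<and> c = c'"
proof -
  have "c = 1" if t: "max_triple k a b c" for a c
  proof (rule ccontr)
    interpret S: max_triple k a b c by fact
    assume "c \<noteq> 1"
    hence "(2 * k + 2) * 2 \<le> (2 * k + 2) * c" using S.a S.ac T.k by (intro mult_left_mono) auto
    thus False using S.c_bound assms by simp
  qed
  hence "c = 1" "c' = 1" using T.max_triple_axioms T'.max_triple_axioms by blast+
  thus ?thesis using T.a T.ac T'.a T'.ac by simp
qed

section \<open>Divisibility by p and the case b = 2p\<close>

lemma prime_dvd_reduce:
  assumes "prime p" "p dvd b" "\<not> p dvd k + 2" "p dvd D * x - k * b * w"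
  shows "p dvd x"
proof -
  have "(k + 2) * x = b * ((3 + 3 * k) * x - k * w) - (D * x - k * b * w)"
    by (simp add: algebra_simps)
  hence "p dvd (k + 2) * x" using assms by simp
  thus ?thesis using assms by (simp add: prime_dvd_mult_iff)
qed

text \<open>For \<open>b = 2 * p\<close>, the factor 4 of \<open>b\<^sup>2\<close> comes from
  parity: \<open>x = b * u\<close> supplies one 2 and, since \<open>D\<close> and \<open>k\<close>
  are even, \<open>D * u - k * w\<close> supplies the other.\<close>

lemma dvd_lift:
  assumes p: "prime p" and "b = p \<or> (b = 2 * p \<and> even k \<and> even x)"
    and pk: "\<not> p dvd k + 2" and odd: "odd p" and P: "p\<^sup>2 dvd D * x - k * b * w"
  shows "b dvd x \<and> b\<^sup>2 dvd D * x - k * b * w"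
proof -
  have pb: "p dvd b" using assms(2) by auto
  have "p dvd D * x - k * b * w" using P by (meson dvd_power dvd_trans zero_less_numeral)
  with p pb pk have px: "p dvd x" by (rule prime_dvd_reduce)
  show ?thesis
  proof (cases "b = p")
    case True
    thus ?thesis using px P by simp
  next
    case False
    hence b2: "b = 2 * p" "even k" "even x" using assms(2) by auto
    have cop: "coprime 2 p" using odd by simp
    have bx: "b dvd x" using b2 px cop by (simp add: divides_mult)
    then obtain u where u: "x = b * u" by blast
    have f: "D * x - k * b * w = b * (D * u - k * w)" unfolding u by (simp add: algebra_simps)
    have "p * p dvd p * (2 * (D * u - k * w))"
      using P unfolding f by (simp only: b2(1) power2_eq_square mult.assoc mult.left_commute)
    hence "p dvd 2 * (D * u - k * w)" using p by (simp add: dvd_mult_cancel_left prime_gt_0_int)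
    hence "p dvd D * u - k * w" using p odd cop
      by (metis coprime_commute coprime_dvd_mult_right_iff)
    moreover have "2 dvd D * u - k * w" using b2 by simp
    ultimately have "b dvd D * u - k * w" using b2 cop by (simp add: divides_mult)
    thus ?thesis using bx unfolding f by (simp add: power2_eq_square)
  qed
qed

text \<open>The bound \<open>3 * k + 4 \<le> b\<close> left by \<open>eq_if_small\<close> makes
  \<open>p\<close> too large to divide \<open>k + 2\<close> or \<open>k - 2\<close>, once
  \<open>p = 2\<close> and \<open>k = 2\<close> are excluded.\<close>

lemma unique:
  assumes p: "prime p" and bp: "b = p \<or> b = 2 * p"
    and cop: "coprime a b" "coprime c b" "coprime a' b" "coprime c' b"
  shows "a = a' \<and> c = c'"
proof (cases "b < 3 * k + 4")
  case True
  thus ?thesis by (rule eq_if_small)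
next
  case False
  have pb: "p dvd b" using bp by auto
  have p2: "2 \<le> p" using p by (rule prime_ge_2_int)
  have np: "\<not> p dvd a" "\<not> p dvd c" "\<not> p dvd a'" "\<not> p dvd c'"
    using cop pb p by (meson coprime_common_divisor not_prime_unit)+
  have ev: "even k \<and> odd a \<and> odd c \<and> odd a' \<and> odd c'" if "even b"
  proof -
    have o: "odd a" "odd c" "odd a'" "odd c'"
      using cop that by (meson coprime_common_divisor odd_one)+
    \<comment> \<open>With \<open>b\<close> even and \<open>a\<close>, \<open>c\<close> odd, the
      equation modulo 2 says that \<open>k\<close> is even.\<close>
    have "even ((3 + 3 * k) * a * b * c)" using that by simp
    hence "even (a\<^sup>2 + b\<^sup>2 + c\<^sup>2 + k * (b * c + c * a + a * b))" by (simp only: T.eq)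
    thus ?thesis using o that by simp
  qed
  have odd: "odd p"
  proof
    assume "even p"
    hence "p = 2" using p using primes_dvd_imp_eq[of 2 p] by simp
    \<comment> \<open>The value \<open>b = 2\<close> is below the bound. Here
      \<open>a = c = 1\<close> will follow, where the equation would read 18 = 12.\<close>
    hence b4: "b = 4" "k = 0" using bp False T.k by auto
    hence "odd c" using ev by auto
    moreover have "c \<le> 2" using T.c_mult_le b4 by simp
    ultimately have "c = 1" using T.a T.ac by (cases "c = 2") auto
    thus False using T.eq T.a T.ac b4 by simp
  qed
  have k2: "k \<noteq> 2"
  proof
    \<comment> \<open>For \<open>k = 2\<close> the equation says \<open>(a + b + c)\<^sup>2 = 9 a b c\<close>, and \<open>p\<close> divides \<open>b\<close> only once.\<close>
    assume "k = 2"
    hence sq: "(a + b + c)\<^sup>2 = 9 * (a * b * c)" using T.eq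
      by (simp add: algebra_simps power2_eq_square)
    hence "p dvd (a + b + c)\<^sup>2" using pb by simp
    hence "p dvd a + b + c" using p by (metis prime_dvd_power)
    hence "p\<^sup>2 dvd 9 * (a * b * c)" unfolding sq[symmetric] by (simp add: dvd_power_same)
    \<comment> \<open>The factor 2 covers \<open>b = p\<close> and \<open>b = 2 * p\<close> at
      once.\<close>
    hence "p * p dvd p * (3 * 3 * 2 * (a * c))" using bp
      by (auto simp: power2_eq_square algebra_simps intro: dvd_trans)
    hence "p dvd 3 * 3 * 2 * (a * c)" using p2 by simp
    hence "p dvd 3 * 3 * 2" using np p prime_dvd_mult_iff by blast
    hence "p dvd 3 \<or> p dvd 2" using p prime_dvd_mult_iff by blast
    hence "p \<le> 3" by (auto dest: zdvd_imp_le)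
    thus False using False \<open>k = 2\<close> bp by auto
  qed
  have 3: "3 \<le> p" using p2 odd by (cases "p = 2") auto
  have big: "3 * k + 4 \<le> 2 * p" using False bp p2 by auto
  have pk: "\<not> p dvd k + 2"
    using zdvd_imp_le[of p "k + 2"] big 3 T.k by auto
  have pk': "\<not> p dvd k - 2"
  proof
    assume "p dvd k - 2"
    hence "p dvd \<bar>k - 2\<bar>" by simp
    hence "p \<le> \<bar>k - 2\<bar>" using k2 by (intro zdvd_imp_le) auto
    thus False using big 3 T.k by linarith
  qed
  let ?P = "D * X - k * b * V" and ?Q = "D * Y - k * b * W"
  have "b\<^sup>2 dvd ?P * ?Q" unfolding product_identity by simp
  moreover have "p\<^sup>2 dvd b\<^sup>2" using pb by (simp add: dvd_power_same)
  ultimately have pq: "p\<^sup>2 dvd ?P * ?Q" by (rule dvd_trans[rotated])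
  \<comment> \<open>Eliminating \<open>a\<close> from \<open>X\<close> and \<open>Y\<close> gives
    \<open>c' = a'\<close> or \<open>c' = -a'\<close> modulo \<open>p\<close>. The Vieta product, a
    multiple of \<open>p\<close>, then becomes \<open>(2 + k) * a'\<^sup>2\<close> or
    \<open>(2 - k) * a'\<^sup>2\<close>.\<close>
  have "\<not> (p dvd ?P \<and> p dvd ?Q)"
  proof
    assume "p dvd ?P \<and> p dvd ?Q"
    hence "p dvd X" "p dvd Y" using prime_dvd_reduce[OF p pb pk] by blast+
    hence "p dvd c' * Y + a' * X" by simp
    also have "c' * Y + a' * X = c * ((c' - a') * (c' + a'))" by (simp add: algebra_simps)
    finally have or: "p dvd c' - a' \<or> p dvd c' + a'" using p np by (simp add: prime_dvd_mult_iff)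
    have q: "p dvd a'\<^sup>2 + c'\<^sup>2 + k * a' * c'" unfolding T'.vieta[symmetric] using pb by simp
    from or show False
    proof
      assume h: "p dvd c' - a'"
      have "(k + 2) * (a' * a') = (a'\<^sup>2 + c'\<^sup>2 + k * a' * c') - (c' - a') * (c' + a' + k * a')"
        by (simp add: algebra_simps power2_eq_square)
      hence "p dvd (k + 2) * (a' * a')" using h q by simp
      thus False using p np pk by (simp add: prime_dvd_mult_iff)
    next
      assume h: "p dvd c' + a'"
      have "(k - 2) * (a' * a') = (c' + a') * (c' - a' + k * a') - (a'\<^sup>2 + c'\<^sup>2 + k * a' * c')"
        by (simp add: algebra_simps power2_eq_square)
      hence "p dvd (k - 2) * (a' * a')" using h q by simp
      thus False using p np pk' by (simp add: prime_dvd_mult_iff)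
    qed
  qed
  hence "coprime (p\<^sup>2) ?P \<or> coprime (p\<^sup>2) ?Q" using p by (auto simp: prime_imp_coprime)
  hence "p\<^sup>2 dvd ?P \<or> p\<^sup>2 dvd ?Q"
    using pq by (metis coprime_dvd_mult_left_iff coprime_dvd_mult_right_iff)
  \<comment> \<open>For even \<open>b\<close> all four other entries are odd, so \<open>X\<close>
    and \<open>Y\<close> are even.\<close>
  moreover have "b = p \<or> b = 2 * p \<and> even k \<and> even X" "b = p \<or> b = 2 * p \<and> even k \<and> even Y"
    using bp ev by auto
  ultimately show ?thesis
    using dvd_lift[OF p _ pk odd] eq_if_dvd_X eq_if_dvd_Y by blast
qed

end


section \<open>Vieta descent on natural triples, coprimality and maxima\<close>

lemma gen_markov_triple_perm:
  "gen_markov_triple k x y z \<Longrightarrow> gen_markov_triple k y x z"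
  "gen_markov_triple k x y z \<Longrightarrow> gen_markov_triple k x z y"
  by (auto simp: gen_markov_triple_def algebra_simps)

lemma max_triple_iff:
  "max_triple (int k) (int a) (int b) (int c)
     \<longleftrightarrow> gen_markov_triple k a b c \<and> a \<le> c \<and> c \<le> b \<and> 2 \<le> b"
proof -
  have "a\<^sup>2 + b\<^sup>2 + c\<^sup>2 + k * (b * c + c * a + a * b) = (3 + 3 * k) * a * b * c \<longleftrightarrow>
    int (a\<^sup>2 + b\<^sup>2 + c\<^sup>2 + k * (b * c + c * a + a * b)) = int ((3 + 3 * k) * a * b * c)"
    by (simp only: of_nat_eq_iff)
  thus ?thesis by (auto simp: max_triple_def gen_markov_triple_def)
qed

text \<open>The maximum is replaced by its conjugate root, which \<open>conj_pos\<close> and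
  \<open>conj_le\<close> place between 1 and \<open>c\<close>.\<close>

lemma gen_markov_triple_descent:
  assumes t: "gen_markov_triple k a b c" and le: "a \<le> c" "c \<le> b" "2 \<le> b"
  obtains b' where "gen_markov_triple k a b' c" "b' \<le> c" "c < b"
    "int b' = (3 + 3 * int k) * int a * int c - int k * (int a + int c) - int b"
proof -
  interpret max_triple "int k" "int a" "int b" "int c"
    using assms max_triple_iff by blast
  let ?v = "(3 + 3 * int k) * int a * int c - int k * (int a + int c) - int b"
  define b' where "b' = nat ?v"
  have b': "int b' = ?v" unfolding b'_def using conj_pos by simp
  have "(int a)\<^sup>2 + (int b')\<^sup>2 + (int c)\<^sup>2
      + int k * (int b' * int c + int c * int a + int a * int b')
      = (3 + 3 * int k) * int a * int b' * int c"
    using eq unfolding b' by algebra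
  hence "int (a\<^sup>2 + b'\<^sup>2 + c\<^sup>2 + k * (b' * c + c * a + a * b')) = int ((3 + 3 * k) * a * b' * c)"
    by simp
  hence "gen_markov_triple k a b' c" unfolding of_nat_eq_iff gen_markov_triple_def
    using t conj_pos b' by (auto simp: gen_markov_triple_def)
  thus thesis using that b' conj_le c_less by simp
qed

text \<open>Two adjacent transpositions generate all orders, so only the order with the maximum in
  the middle has to be treated.\<close>

lemma gen_markov_triple_sorted_wlog:
  assumes "\<And>a b c. a \<le> c \<Longrightarrow> c \<le> b \<Longrightarrow> gen_markov_triple k a b c \<Longrightarrow> P a b c"
    and "\<And>a b c. P a b c \<Longrightarrow> P b a c" "\<And>a b c. P a b c \<Longrightarrow> P a c b"
    and t: "gen_markov_triple k x y z"
  shows "P x y z"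
proof -
  note perm = gen_markov_triple_perm assms(2,3)
  consider "x \<le> y" "y \<le> z" | "x \<le> z" "z \<le> y" | "y \<le> x" "x \<le> z"
    | "y \<le> z" "z \<le> x" | "z \<le> x" "x \<le> y" | "z \<le> y" "y \<le> x"
    by (metis linear)
  thus ?thesis
  proof cases
    case 1
    show ?thesis by (rule perm(4)[OF assms(1)[OF 1 perm(2)[OF t]]])
  next
    case 2
    show ?thesis by (rule assms(1)[OF 2 t])
  next
    case 3
    show ?thesis by (rule perm(3)[OF perm(4)[OF assms(1)[OF 3 perm(2)[OF perm(1)[OF t]]]]])
  next
    case 4
    show ?thesis by (rule perm(3)[OF assms(1)[OF 4 perm(1)[OF t]]])
  next
    case 5
    show ?thesis
      by (rule perm(3)[OF perm(4)[OF perm(3)[OF assms(1)[OF 5 perm(1)[OF perm(2)[OF perm(1)[OF t]]]]]]])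
  next
    case 6
    show ?thesis by (rule perm(4)[OF perm(3)[OF assms(1)[OF 6 perm(1)[OF perm(2)[OF t]]]]])
  qed
qed

text \<open>Descent as an induction rule: each jump lowers the sum of the entries, and it stops only
  at \<open>(1, 1, 1)\<close>.\<close>

lemma gen_markov_triple_induct [consumes 1, case_names one step perm1 perm2]:
  assumes "gen_markov_triple k x y z"
    and one: "P 1 1 1"
    and step: "\<And>a b b' c. gen_markov_triple k a b c \<Longrightarrow> a \<le> c \<Longrightarrow> c < b \<Longrightarrow> P a b' c \<Longrightarrow>
      int b' = (3 + 3 * int k) * int a * int c - int k * (int a + int c) - int b \<Longrightarrow> P a b c"
    and perm: "\<And>a b c. P a b c \<Longrightarrow> P b a c" "\<And>a b c. P a b c \<Longrightarrow> P a c b"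
  shows "P x y z"
  using assms(1)
proof (induction "x + y + z" arbitrary: x y z rule: less_induct)
  case less
  \<comment> \<open>Fixing the sum inside \<open>?Q\<close> keeps the induction hypothesis usable
    after sorting.\<close>
  let ?Q = "\<lambda>a b c. a + b + c = x + y + z \<longrightarrow> P a b c"
  have "?Q x y z"
  proof (rule gen_markov_triple_sorted_wlog[where P = ?Q, OF _ _ _ less.prems])
    fix a b c assume t: "a \<le> c" "c \<le> b" "gen_markov_triple k a b c"
    show "?Q a b c"
    proof (intro impI, cases "2 \<le> b")
      case True
      assume s: "a + b + c = x + y + z"
      obtain b' where b': "gen_markov_triple k a b' c" "b' \<le> c" "c < b"
        "int b' = (3 + 3 * int k) * int a * int c - int k * (int a + int c) - int b"
        using gen_markov_triple_descent[OF t(3,1,2) True] by blast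
      have "P a b' c" using s b' by (intro less.hyps) auto
      thus "P a b c" using step t b' by blast
    next
      case False
      hence "a = 1" "b = 1" "c = 1" using t by (auto simp: gen_markov_triple_def)
      thus "P a b c" using one by simp
    qed
  next
    fix a b c assume "?Q a b c"
    thus "?Q b a c" "?Q a c b" using perm(1)[of a b c] perm(2)[of a b c] by simp_all
  qed
  thus ?case by simp
qed

text \<open>A common divisor of \<open>a\<close>, \<open>b\<close>, \<open>c\<close> divides
  \<open>b'\<close>, an integral expression in them, so it survives the descent to
  \<open>(1, 1, 1)\<close>.\<close>

lemma gen_markov_triple_gcd:
  "gen_markov_triple k x y z \<Longrightarrow> gcd (int x) (gcd (int y) (int z)) = 1"
proof (induction rule: gen_markov_triple_induct)
  case (step a b b' c)
  let ?g = "gcd (int a) (gcd (int b) (int c))"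
  have "?g dvd int a" "?g dvd int b" "?g dvd int c"
    by (meson dvd_trans gcd_dvd1 gcd_dvd2)+
  hence "?g dvd int b'" unfolding step.hyps(4) by simp
  with \<open>?g dvd int a\<close> \<open>?g dvd int c\<close> have "?g dvd gcd (int a) (gcd (int b') (int c))"
    by (intro gcd_greatest)
  hence "is_unit ?g" by (simp only: step.IH)
  thus ?case by (simp only: is_unit_gcd_iff)
next
  case (perm1 a b c)
  thus ?case by (simp only: gcd.left_commute)
next
  case (perm2 a b c)
  thus ?case by (simp only: gcd.commute)
qed simp

text \<open>A prime dividing \<open>x\<close> and \<open>y\<close> divides every term of the
  equation except \<open>z\<^sup>2\<close>, hence also \<open>z\<close>, against
  \<open>gen_markov_triple_gcd\<close>.\<close>

lemma gen_markov_triple_coprime: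
  assumes t: "gen_markov_triple k x y z"
  shows "coprime (int x) (int y)"
proof (rule ccontr)
  assume "\<not> coprime (int x) (int y)"
  then obtain d where d: "d dvd int x" "d dvd int y" "\<not> is_unit d" by (rule not_coprimeE)
  have "d \<noteq> 0" using d(1) t by (auto simp: gen_markov_triple_def)
  then obtain p where "prime p" "p dvd d" using d(3) prime_divisor_exists by blast
  hence p: "prime p" "p dvd int x" "p dvd int y" using d dvd_trans by blast+
  have "int (x\<^sup>2 + y\<^sup>2 + z\<^sup>2 + k * (y * z + z * x + x * y)) = int ((3 + 3 * k) * x * y * z)"
    using t by (simp only: gen_markov_triple_def)
  hence "(int z)\<^sup>2 = int x * ((3 + 3 * int k) * int y * int z - int x - int k * (int z + int y))
      - int y * (int y + int k * int z)"
    by (simp add: algebra_simps power2_eq_square)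
  hence "p dvd (int z)\<^sup>2" using p by simp
  hence "p dvd int z" using p by (metis prime_dvd_power)
  with p have "p dvd gcd (int x) (gcd (int y) (int z))" by (intro gcd_greatest)
  thus False using gen_markov_triple_gcd[OF t] p(1) not_prime_unit by metis
qed

text \<open>In the step of the descent, the new entry \<open>b\<close> is the maximum of its own
  triple, while \<open>a\<close> and \<open>c\<close> already occur in the smaller one.\<close>

lemma gen_markov_number_max:
  assumes "gen_markov_triple k x y z" "n \<in> {x, y, z}"
  shows "\<exists>a c. gen_markov_triple k a n c \<and> a \<le> c \<and> c \<le> n"
proof -
  have "\<forall>n\<in>{x, y, z}. \<exists>a c. gen_markov_triple k a n c \<and> a \<le> c \<and> c \<le> n"
    using assms(1)
  proof (induction rule: gen_markov_triple_induct)
    case one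
    have "gen_markov_triple k 1 1 1" by (simp add: gen_markov_triple_def)
    thus ?case by auto
  next
    case (step a b b' c)
    thus ?case using less_imp_le by blast
  qed auto
  thus ?thesis using assms(2) by blast
qed

section \<open>Triples up to order as multisets\<close>

lemma sorted_max_triple:
  assumes "gen_markov_triple k a b c" "Max {a, b, c} = b"
  obtains a' c' where "{#a, b, c#} = {#a', b, c'#}" "gen_markov_triple k a' b c'" "a' \<le> c'" "c' \<le> b"
proof (cases "a \<le> c")
  case True
  thus thesis using assms that[of a c] by (auto simp: max_def split: if_splits)
next
  case False
  have "gen_markov_triple k c b a" using assms(1) gen_markov_triple_perm by blast
  thus thesis using assms False that[of c a] by (auto simp: max_def split: if_splits)
qed

theorem theorem1p6:
  fixes k b :: nat
  assumes "gen_markov_number k b"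
    and "\<exists>p::nat. prime p \<and> (b = p \<or> b = 2 * p)"
  shows "\<exists>!T :: nat multiset.
           \<exists>a c. T = {#a, b, c#} \<and> gen_markov_triple k a b c \<and> Max {a, b, c} = b"
proof (rule ex_ex1I)
  obtain a c where "gen_markov_triple k a b c" "a \<le> c" "c \<le> b"
    using assms(1) gen_markov_number_max unfolding gen_markov_number_def by blast
  thus "\<exists>T a c. T = {#a, b, c#} \<and> gen_markov_triple k a b c \<and> Max {a, b, c} = b"
    by (intro exI[of _ "{#a, b, c#}"] exI[of _ a] exI[of _ c]) (auto simp: max_def)
next
  fix T T' :: "nat multiset"
  assume T: "\<exists>a c. T = {#a, b, c#} \<and> gen_markov_triple k a b c \<and> Max {a, b, c} = b"
    and T': "\<exists>a c. T' = {#a, b, c#} \<and> gen_markov_triple k a b c \<and> Max {a, b, c} = b"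
  obtain a c where ac: "T = {#a, b, c#}" "gen_markov_triple k a b c" "a \<le> c" "c \<le> b"
    using T sorted_max_triple by metis
  obtain a' c' where ac': "T' = {#a', b, c'#}" "gen_markov_triple k a' b c'" "a' \<le> c'" "c' \<le> b"
    using T' sorted_max_triple by metis
  obtain p where p: "prime p" "b = p \<or> b = 2 * p" using assms(2) by blast
  have "2 \<le> b" using p prime_ge_2_nat[of p] by auto
  hence "max_triple (int k) (int a) (int b) (int c)" "max_triple (int k) (int a') (int b) (int c')"
    using ac ac' max_triple_iff by blast+
  then interpret max_triple_pair "int k" "int a" "int b" "int c" "int a'" "int c'"
    by (rule max_triple_pair.intro)
  have "int a = int a' \<and> int c = int c'"
    using p ac(2) ac'(2)
    by (intro unique[of "int p"] gen_markov_triple_coprime)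
       (auto intro: gen_markov_triple_perm)
  thus "T = T'" using ac ac' by simp
qed

end
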